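(* Let $\gamma:=1.0321$, $p:=\gamma^{40}$, $q:=\gamma^{31}$, $\alpha:=1-\frac2p$ and $\beta:=1-\frac2q$, and let $C_\alpha$, $C_\beta$ be the corresponding middle Cantor sets. Then for each $\lambda\in\mathbb{R}\setminus\{0\}$ the set $C_\alpha-\lambda C_\beta=\{x-\lambda y : x\in C_\alpha,\ y\in C_\beta\}$ contains at least one (nondegenerate) interval.
   Context: For a real number $m>2$ and $\mu:=1-\frac2m$, the middle-$\mu$ Cantor set is $$C_\mu:=\Big\{x\in\mathbb{R} : x=\big(1-\tfrac1m\big)\sum_{i=0}^\infty\frac{a_i}{m^i},\ a_i\in\{0,1\}\Big\}.$$ Thus $C_\alpha$ is obtained with $m=p$ and $C_\beta$ with $m=q$. *)

theory Defs
  imports "HOL-Analysis.Analysis"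
begin

(* The parameter mu determines m by mu = 1 - 2/m, i.e. m = 2/(1 - mu);
   0 < mu < 1 corresponds to m > 2, where the series converges. *)
definition middle_cantor :: "real \<Rightarrow> real set" where
  "middle_cantor \<mu> =
     (let m = 2 / (1 - \<mu>)
      in {x. \<exists>a :: nat \<Rightarrow> real. (\<forall>i. a i \<in> {0, 1}) \<and>
               x = (1 - 1 / m) * (\<Sum>i. a i / m ^ i)})"

end

theory Submission
  imports Defs
begin

text \<open>
  Both Cantor sets are symmetric, so up to a translation \<open>C\<^sub>\<alpha> - l C\<^sub>\<beta>\<close> is the sum set
  \<open>E(l) = C\<^sub>\<alpha> + \<bar>l\<bar> C\<^sub>\<beta>\<close>, which lies in \<open>[0, 1 + \<bar>l\<bar>]\<close>. Self-similarity makes \<open>E(l)\<close> a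
  union of two copies of \<open>E(p l)\<close> scaled by \<open>1/p\<close>, and also of two translates of \<open>E(l/q)\<close>. As
  \<open>p\<close> and \<open>q\<close> are powers of \<open>\<gamma>\<close> with coprime exponents, having an interval is invariant under
  \<open>l \<mapsto> \<gamma> l\<close>, and one may assume \<open>\<alpha>/\<gamma> < l \<le> \<alpha>\<close>. Stepping the exponent of
  \<open>\<gamma>\<close> by \<open>+31\<close> or \<open>-40\<close> visits all residues modulo \<open>71\<close> in a cycle. If an interval
  at one parameter is within distance \<open>d\<close> of the sum set, then going around the cycle shows that
  the same interval is within distance \<open>d/p\<close>; hence it is contained in the closed set \<open>E\<close>.

  The copies of the full intervals \<open>[0, 1 + l]\<close> overlap along the whole cycle if
  \<open>l p (q - 2) \<le> 1\<close>. Otherwise, since \<open>(p - 2)(q - 2)\<close> slightly exceeds \<open>1\<close>, they leave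
  one small gap at exponent \<open>0\<close>. A few steps later the overlaps have covered all images of this gap
  except four that approach the two ends of the interval, so that slightly trimmed intervals
  \<open>[e, 1 + l - e]\<close> complete the cycle.
\<close>

section \<open>Middle Cantor sets: compactness, self-similarity, symmetry\<close>

definition cantor_set :: "real \<Rightarrow> real set" where
  "cantor_set m = (\<lambda>a. (1 - 1 / m) * (\<Sum>i. a i / m ^ i)) ` (UNIV \<rightarrow>\<^sub>E {0, 1})"

lemma middle_cantor_eq:
  assumes "m > 0"
  shows "middle_cantor (1 - 2 / m) = cantor_set m"
  using assms by (auto simp: middle_cantor_def cantor_set_def PiE_UNIV_domain Pi_def)

lemma summable_digits:
  fixes m :: real
  assumes "m > 1" "a \<in> UNIV \<rightarrow>\<^sub>E {0, 1}"
  shows "summable (\<lambda>i. a i / m ^ i)"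
proof (rule summable_comparison_test)
  show "summable (\<lambda>i. (1 / m) ^ i)"
    using assms(1) by (intro summable_geometric) auto
  have "a i \<in> {0, 1}" for i
    using assms(2) by (auto simp: PiE_UNIV_domain Pi_def)
  then have "\<bar>a i\<bar> \<le> 1" for i
    by (metis abs_0 abs_1 insert_iff empty_iff order_refl zero_le_one)
  then show "\<exists>N. \<forall>i\<ge>N. norm (a i / m ^ i) \<le> (1 / m) ^ i"
    using assms(1) by (auto simp: power_divide divide_right_mono)
qed

text \<open>Digit sequences form a compact set by Tychonoff's theorem, and the M-test makes the
  series a uniform limit of continuous functions of the digits.\<close>

lemma compact_cantor_set:
  assumes "m > 1"
  shows "compact (cantor_set m)"
proof -
  let ?X = "UNIV \<rightarrow>\<^sub>E {0, 1} :: (nat \<Rightarrow> real) set"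
  have "compactin (product_topology (\<lambda>i::nat. euclidean) UNIV) ?X"
    unfolding compactin_PiE by (auto simp: finite_imp_compactin)
  then have X: "compact ?X"
    by (simp add: euclidean_product_topology)
  have "uniform_limit ?X (\<lambda>n a. \<Sum>i<n. a i / m ^ i) (\<lambda>a. \<Sum>i. a i / m ^ i) sequentially"
  proof (rule Weierstrass_m_test)
    show "summable (\<lambda>i. (1 / m) ^ i)"
      using assms by (intro summable_geometric) auto
    fix i and a :: "nat \<Rightarrow> real" assume "a \<in> ?X"
    then have "a i \<in> {0, 1}"
      by (auto simp: PiE_UNIV_domain Pi_def)
    then have "\<bar>a i\<bar> \<le> 1"
      by auto
    then show "norm (a i / m ^ i) \<le> (1 / m) ^ i"
      using assms by (auto simp: power_divide divide_right_mono)
  qed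
  then have "continuous_on ?X (\<lambda>a. \<Sum>i. a i / m ^ i)"
    by (rule uniform_limit_theorem[rotated])
      (use assms in \<open>auto intro!: always_eventually continuous_intros
        continuous_on_subset[OF continuous_on_product_coordinates]\<close>)
  then show ?thesis
    unfolding cantor_set_def by (intro compact_continuous_image continuous_intros X)
qed

lemma zero_in_cantor_set: "0 \<in> cantor_set m"
  unfolding cantor_set_def by (rule image_eqI[of _ _ "\<lambda>_. 0"]) auto

text \<open>The digit \<open>d\<close> is prepended to an expansion of \<open>x\<close>.\<close>

lemma cantor_set_cons:
  assumes "m > 1" "x \<in> cantor_set m" "d \<in> {0, 1}"
  shows "x / m + d * (1 - 1 / m) \<in> cantor_set m"
proof -
  obtain a where a: "a \<in> UNIV \<rightarrow>\<^sub>E {0, 1}" and x: "x = (1 - 1 / m) * (\<Sum>i. a i / m ^ i)"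
    using assms(2) by (auto simp: cantor_set_def)
  define b where "b = case_nat d a"
  have b: "b \<in> UNIV \<rightarrow>\<^sub>E {0, 1}"
    using a assms(3) by (auto simp: b_def PiE_UNIV_domain Pi_def split: nat.split)
  have "(\<Sum>i. b i / m ^ i) = (\<Sum>i. b (Suc i) / m ^ Suc i) + b 0 / m ^ 0"
    using suminf_split_head[OF summable_digits[OF assms(1) b]] by simp
  also have "(\<Sum>i. b (Suc i) / m ^ Suc i) = (\<Sum>i. (1 / m) * (a i / m ^ i))"
    by (simp add: b_def)
  also have "\<dots> = (1 / m) * (\<Sum>i. a i / m ^ i)"
    by (rule suminf_mult[OF summable_digits[OF assms(1) a]])
  finally have "x / m + d * (1 - 1 / m) = (1 - 1 / m) * (\<Sum>i. b i / m ^ i)"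
    by (simp add: x b_def algebra_simps)
  then show ?thesis
    using b unfolding cantor_set_def by blast
qed

text \<open>Exchange the digits 0 and 1; the sequence of all ones represents 1.\<close>

lemma cantor_set_reflect:
  assumes "m > 1" "x \<in> cantor_set m"
  shows "1 - x \<in> cantor_set m"
proof -
  obtain a where a: "a \<in> UNIV \<rightarrow>\<^sub>E {0, 1}" and x: "x = (1 - 1 / m) * (\<Sum>i. a i / m ^ i)"
    using assms(2) by (auto simp: cantor_set_def)
  define b where "b = (\<lambda>i. 1 - a i)"
  have b: "b \<in> UNIV \<rightarrow>\<^sub>E {0, 1}"
    using a by (auto simp: b_def PiE_UNIV_domain Pi_def)
  have "(\<lambda>i. (1 / m) ^ i) sums (1 / (1 - 1 / m))"
    using assms(1) by (intro geometric_sums) auto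
  then have "(\<lambda>i. (1 / m) ^ i - a i / m ^ i) sums (1 / (1 - 1 / m) - (\<Sum>i. a i / m ^ i))"
    using summable_sums[OF summable_digits[OF assms(1) a]] by (rule sums_diff)
  then have "(\<Sum>i. b i / m ^ i) = 1 / (1 - 1 / m) - (\<Sum>i. a i / m ^ i)"
    by (intro sums_unique[symmetric]) (simp add: b_def power_divide diff_divide_distrib)
  then have "1 - x = (1 - 1 / m) * (\<Sum>i. b i / m ^ i)"
    using assms(1) by (simp add: x right_diff_distrib)
  then show ?thesis
    using b unfolding cantor_set_def by blast
qed

section \<open>The cycle of exponents modulo 71\<close>

text \<open>Modulo 71 the steps +31 and -40 agree. The residue 40 occurs only at
  \<open>j = 70\<close>, so a step by -40 never reaches the exponent 0.\<close>

lemma residue_step: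
  assumes "0 < j" "j < (70::nat)"
  shows "31 * j mod 71 < 40 \<and> 31 * Suc j mod 71 = 31 * j mod 71 + 31 \<or>
         40 < 31 * j mod 71 \<and> 31 * Suc j mod 71 + 40 = 31 * j mod 71"
proof -
  let ?c = "31 * j mod 71"
  have "?c \<noteq> 40"
  proof
    assume c: "?c = 40"
    \<comment> \<open>\<open>55\<close> is the inverse of \<open>31\<close> modulo \<open>71\<close>.\<close>
    have "j mod 71 = (j + 71 * (24 * j)) mod 71"
      by (rule mod_mult_self2[symmetric])
    also have "j + 71 * (24 * j) = 55 * (31 * j)"
      by simp
    also have "(55 * (31 * j)) mod 71 = (55 * ?c) mod 71"
      by (rule mod_mult_right_eq[symmetric])
    finally show False
      using assms c by simp
  qed
  have next_c: "31 * Suc j mod 71 = (?c + 31) mod 71"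
    by (metis mult_Suc_right add.commute mod_add_left_eq)
  show ?thesis
  proof (cases "?c < 40")
    case True
    then have "(?c + 31) mod 71 = ?c + 31"
      by (intro mod_less) simp
    with True next_c show ?thesis by argo
  next
    case False
    with \<open>?c \<noteq> 40\<close> have gt: "40 < ?c" by linarith
    then have "?c + 31 = (?c - 40) + 71" by linarith
    then have "(?c + 31) mod 71 = (?c - 40) mod 71"
      by (metis mod_add_self2)
    also have "?c - 40 < 71"
      using mod_less_divisor[of 71 "31 * j"] by linarith
    then have "(?c - 40) mod 71 = ?c - 40"
      by (rule mod_less)
    finally show ?thesis using gt next_c by linarith
  qed
qed

section \<open>The sum set, its self-similarity and symmetry\<close>

locale cantor_sum =
  fixes p q :: real
  assumes p_gt_1: "p > 1" and q_gt_1: "q > 1"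
begin

definition sumset :: "real \<Rightarrow> real set" where
  "sumset l = {x + l * y | x y. x \<in> cantor_set p \<and> y \<in> cantor_set q}"

text \<open>A digit is prepended in \<open>cantor_set p\<close>; rescaling by \<open>1 / p\<close>
  turns the parameter \<open>p * l\<close> into \<open>l\<close>.\<close>

lemma sumset_p:
  assumes "s \<in> sumset (p * l)"
  shows "s / p \<in> sumset l" and "(s + p - 1) / p \<in> sumset l"
proof -
  obtain x y where s: "s = x + p * l * y" and x: "x \<in> cantor_set p" and y: "y \<in> cantor_set q"
    using assms by (auto simp: sumset_def)
  have "s / p = x / p + l * y" "(s + p - 1) / p = (x / p + (1 - 1 / p)) + l * y"
    using p_gt_1 by (auto simp: s field_simps)
  moreover have "x / p \<in> cantor_set p" "x / p + (1 - 1 / p) \<in> cantor_set p"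
    using cantor_set_cons[OF p_gt_1 x, of 0] cantor_set_cons[OF p_gt_1 x, of 1] by auto
  ultimately show "s / p \<in> sumset l" and "(s + p - 1) / p \<in> sumset l"
    using y unfolding sumset_def by blast+
qed

text \<open>A digit is prepended in \<open>cantor_set q\<close>; the growing parameter absorbs the
  scaling, so only translations remain.\<close>

lemma sumset_q:
  assumes "s \<in> sumset l"
  shows "s \<in> sumset (q * l)" and "s + l * (q - 1) \<in> sumset (q * l)"
proof -
  obtain x y where s: "s = x + l * y" and x: "x \<in> cantor_set p" and y: "y \<in> cantor_set q"
    using assms by (auto simp: sumset_def)
  have "s = x + q * l * (y / q)" "s + l * (q - 1) = x + q * l * (y / q + (1 - 1 / q))"
    using q_gt_1 by (auto simp: s field_simps)
  moreover have "y / q \<in> cantor_set q" "y / q + (1 - 1 / q) \<in> cantor_set q"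
    using cantor_set_cons[OF q_gt_1 y, of 0] cantor_set_cons[OF q_gt_1 y, of 1] by auto
  ultimately show "s \<in> sumset (q * l)" and "s + l * (q - 1) \<in> sumset (q * l)"
    using x unfolding sumset_def by blast+
qed

lemma sumset_reflect:
  assumes "s \<in> sumset l"
  shows "1 + l - s \<in> sumset l"
proof -
  obtain x y where s: "s = x + l * y" and x: "x \<in> cantor_set p" and y: "y \<in> cantor_set q"
    using assms by (auto simp: sumset_def)
  have "1 + l - s = (1 - x) + l * (1 - y)"
    by (simp add: s algebra_simps)
  then show ?thesis
    using cantor_set_reflect[OF p_gt_1 x] cantor_set_reflect[OF q_gt_1 y]
    unfolding sumset_def by blast
qed

lemma zero_in_sumset: "0 \<in> sumset l"
  using zero_in_cantor_set[of p] zero_in_cantor_set[of q] by (force simp: sumset_def)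

lemma closed_sumset: "closed (sumset l)"
proof -
  have "compact {x + y | x y. x \<in> cantor_set p \<and> y \<in> (*\<^sub>R) l ` cantor_set q}"
    using p_gt_1 q_gt_1 by (intro compact_sums compact_scaling compact_cantor_set)
  also have "{x + y | x y. x \<in> cantor_set p \<and> y \<in> (*\<^sub>R) l ` cantor_set q} = sumset l"
    by (auto simp: sumset_def)
  finally show ?thesis
    by (rule compact_imp_closed)
qed

section \<open>Intervals approximated by the sum set\<close>

text \<open>A version of \<open>{a..b} \<subseteq> sumset l\<close> with error \<open>d\<close>:
  steps by \<open>p\<close> shrink the error, steps by \<open>q\<close> preserve it.\<close>

definition near :: "real \<Rightarrow> real \<Rightarrow> real \<Rightarrow> real \<Rightarrow> bool" where
  "near d l a b \<longleftrightarrow> (\<forall>t\<in>{a..b}. \<exists>s\<in>sumset l. \<bar>t - s\<bar> \<le> d)"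

lemma near_mono:
  assumes "near d l a b" "d \<le> d'" "a \<le> a'" "b' \<le> b"
  shows "near d' l a' b'"
  unfolding near_def
proof
  fix t assume "t \<in> {a'..b'}"
  then have "t \<in> {a..b}" using assms by auto
  then obtain s where "s \<in> sumset l" "\<bar>t - s\<bar> \<le> d"
    using assms(1) unfolding near_def by blast
  then show "\<exists>s\<in>sumset l. \<bar>t - s\<bar> \<le> d'"
    using assms(2) by force
qed

lemma near_union:
  assumes "near d l a b" "near d l a' b'" "a' \<le> b"
  shows "near d l a b'"
  unfolding near_def
proof
  fix t assume "t \<in> {a..b'}"
  then have "t \<in> {a..b} \<or> t \<in> {a'..b'}" using assms(3) by auto
  then show "\<exists>s\<in>sumset l. \<bar>t - s\<bar> \<le> d"
    using assms(1,2) unfolding near_def by blast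
qed

lemma near_image:
  assumes "near d l a b" "\<And>s. s \<in> sumset l \<Longrightarrow> f s \<in> sumset l'"
    and "\<And>t. t \<in> {a'..b'} \<Longrightarrow> \<exists>t'\<in>{a..b}. t = f t'"
    and "\<And>s t. \<bar>s - t\<bar> \<le> d \<Longrightarrow> \<bar>f s - f t\<bar> \<le> d'"
  shows "near d' l' a' b'"
  using assms unfolding near_def by metis

lemma near_p:
  assumes "near d (p * l) a b"
  shows "near (d / p) l (a / p) (b / p)"
    and "near (d / p) l ((a + p - 1) / p) ((b + p - 1) / p)"
proof -
  have *: "\<bar>s / p - t / p\<bar> \<le> d / p" if "\<bar>s - t\<bar> \<le> d" for s t
    using that p_gt_1 by (simp flip: diff_divide_distrib add: divide_right_mono)
  show "near (d / p) l (a / p) (b / p)"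
  proof (rule near_image[OF assms, of "\<lambda>s. s / p"])
    fix t assume "t \<in> {a / p..b / p}"
    then show "\<exists>t'\<in>{a..b}. t = t' / p"
      using p_gt_1 by (intro bexI[of _ "p * t"]) (auto simp: field_simps)
  qed (use * sumset_p in auto)
  show "near (d / p) l ((a + p - 1) / p) ((b + p - 1) / p)"
  proof (rule near_image[OF assms, of "\<lambda>s. (s + p - 1) / p"])
    fix t assume "t \<in> {(a + p - 1) / p..(b + p - 1) / p}"
    then show "\<exists>t'\<in>{a..b}. t = (t' + p - 1) / p"
      using p_gt_1 by (intro bexI[of _ "p * t - p + 1"]) (auto simp: field_simps)
  next
    fix s t assume "\<bar>s - t\<bar> \<le> d"
    then show "\<bar>(s + p - 1) / p - (t + p - 1) / p\<bar> \<le> d / p"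
      using *[of s t] by (simp add: diff_divide_distrib add_divide_distrib)
  qed (use sumset_p in auto)
qed

lemma near_q:
  assumes "near d l a b"
  shows "near d (q * l) a b" and "near d (q * l) (a + l * (q - 1)) (b + l * (q - 1))"
proof -
  show "near d (q * l) a b"
    by (rule near_image[OF assms, of "\<lambda>s. s"]) (use sumset_q in auto)
  show "near d (q * l) (a + l * (q - 1)) (b + l * (q - 1))"
  proof (rule near_image[OF assms, of "\<lambda>s. s + l * (q - 1)"])
    fix t assume "t \<in> {a + l * (q - 1)..b + l * (q - 1)}"
    then show "\<exists>t'\<in>{a..b}. t = t' + l * (q - 1)"
      by (intro bexI[of _ "t - l * (q - 1)"]) auto
  qed (use sumset_q in auto)
qed

lemma near_reflect:
  assumes "near d l a b"
  shows "near d l (1 + l - b) (1 + l - a)"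
proof (rule near_image[OF assms, of "\<lambda>s. 1 + l - s"])
  fix t assume "t \<in> {1 + l - b..1 + l - a}"
  then show "\<exists>t'\<in>{a..b}. t = 1 + l - t'"
    by (intro bexI[of _ "1 + l - t"]) auto
qed (use sumset_reflect in auto)

text \<open>An interval reaching the centre \<open>(1 + l) / 2\<close> meets its mirror
  image.\<close>

lemma near_central:
  assumes "near d l a b" "1 + l \<le> 2 * b"
  shows "near d l a (1 + l - a)"
  using near_union[OF assms(1) near_reflect[OF assms(1)]] assms(2) by simp

text \<open>The inequality makes the two scaled copies meet; trim and error both shrink by the
  factor \<open>p\<close>.\<close>

lemma near_central_p:
  assumes "near d (p * l) e (1 + p * l - e)" "p - 2 + 2 * e \<le> p * l"
  shows "near (d / p) l (e / p) (1 + l - e / p)"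
proof -
  have "(1 + p * l - e + p - 1) / p = 1 + l - e / p"
    using p_gt_1 by (simp add: field_simps)
  moreover have "(e + p - 1) / p \<le> (1 + p * l - e) / p"
    using assms(2) p_gt_1 by (intro divide_right_mono) auto
  ultimately show ?thesis
    using near_union[OF near_p[OF assms(1)]] by simp
qed

text \<open>The inequality makes the two translates meet; trim and error stay the same.\<close>

lemma near_central_q:
  assumes "near d l e (1 + l - e)" "l * (q - 2) + 2 * e \<le> 1"
  shows "near d (q * l) e (1 + q * l - e)"
proof -
  have *: "1 + l - e + l * (q - 1) = 1 + q * l - e"
    by (simp add: algebra_simps)
  have "e + l * (q - 1) \<le> 1 + l - e"
    using assms(2) by (simp add: algebra_simps)
  then show ?thesis
    using near_union[OF near_q[OF assms(1)], unfolded *] by simp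
qed

text \<open>The single point 0 gives the crude approximation that starts the iteration.\<close>

lemma near_zero:
  assumes "a \<ge> 0"
  shows "near b l a b"
  unfolding near_def using assms zero_in_sumset[of l] by (auto intro!: bexI[of _ 0])

lemma near_limit:
  assumes "\<And>n::nat. near (d * r ^ n) l a b" "\<bar>r\<bar> < 1"
  shows "{a..b} \<subseteq> sumset l"
proof
  fix t assume t: "t \<in> {a..b}"
  have "\<exists>s. s \<in> sumset l \<and> \<bar>t - s\<bar> \<le> d * r ^ n" for n
    using assms(1)[of n] t unfolding near_def by blast
  then obtain s where s: "\<And>n. s n \<in> sumset l" and lim: "\<And>n. \<bar>t - s n\<bar> \<le> d * r ^ n"
    by metis
  have "(\<lambda>n. d * r ^ n) \<longlonglongrightarrow> 0"
    using LIMSEQ_power_zero[of r] assms(2) by (intro tendsto_mult_right_zero) simp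
  then have "(\<lambda>n. t - s n) \<longlonglongrightarrow> 0"
    by (rule Lim_null_comparison[rotated]) (simp add: lim)
  then have "(\<lambda>n. t - (t - s n)) \<longlonglongrightarrow> t - 0"
    by (rule tendsto_diff[OF tendsto_const])
  then have "s \<longlonglongrightarrow> t"
    by simp
  with closed_sumset s show "t \<in> sumset l"
    by (rule closed_sequentially)
qed

section \<open>Covering the images of the gap\<close>

text \<open>For \<open>p\<close> = \<gamma>^40 and \<open>q\<close> = \<gamma>^31 the parameter is
  \<open>l\<close> times \<gamma> to the powers 40, 0, 31, 62, 22, 53, 13, 44, 4 in turn; these
  exponents number the facts below.\<close>

lemma near_gap_chain:
  assumes p: "3.538923 \<le> p" "p \<le> 3.538924" and q: "2.663024 \<le> q" "q \<le> 2.663025"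
    and l: "0.42618 \<le> l" "l \<le> 0.43486" and e: "0 \<le> e" "e \<le> 0.003"
    and near: "near d (p * l) e (1 + p * l - e)"
  shows "near (d / p / p / p / p) (q * (q * (q * (q * l))) / p / p / p) 0.033
           (1 + q * (q * (q * (q * l))) / p / p / p - 0.033)"
proof -
  \<comment> \<open>The intervals at \<open>l\<close> leave the gap between \<open>A\<close> and \<open>B\<close>. Its images are the only gaps of
    the later stages near the left end (the right end is symmetric); every gap further inside is
    covered by the other child. The variables \<open>x1\<close>, ..., \<open>x4\<close> keep the numerical conditions
    linear.\<close>
  define r where "r = 1 / p"
  define h where "h = e / p"
  define A where "A = (1 + p * l - e) / p"
  define B where "B = (e + p - 1) / p"
  define x1 where "x1 = q * l"
  define x2 where "x2 = q * x1"
  define x3 where "x3 = q * x2"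
  define x4 where "x4 = q * x3"
  \<comment> \<open>Right end of the second image of the gap, after one scaling by
    \<open>1 / p\<close>.\<close>
  define D where "D = (B + (x1 - l)) / p"
  have p0: "p > 0" using p by simp
  have r: "0.282571 \<le> r" "r \<le> 0.282572"
    using p by (auto simp: r_def field_simps)
  have h: "0 \<le> h" "h \<le> 0.001"
    using e p by (auto simp: h_def field_simps)
  have A: "A = l + r - h" and B: "B = 1 - r + h"
    using p0 by (auto simp: A_def B_def r_def h_def field_simps)
  have x1: "2.663024 * l \<le> x1" "x1 \<le> 2.663025 * l"
    using q l by (auto simp: x1_def)
  have pos1: "0 \<le> x1"
    using x1 l by linarith
  \<comment> \<open>The coefficients here and below are successive products of the bounds for
    \<open>q\<close>, rounded outward.\<close>
  have x2: "7.091696 * l \<le> x2" "x2 \<le> 7.091703 * l"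
    using mult_right_mono[OF q(1) pos1, folded x2_def] mult_right_mono[OF q(2) pos1, folded x2_def] x1 l
    by simp_all
  have pos2: "0 \<le> x2"
    using x2 l by linarith
  have x3: "18.88535 * l \<le> x3" "x3 \<le> 18.88539 * l"
    using mult_right_mono[OF q(1) pos2, folded x3_def] mult_right_mono[OF q(2) pos2, folded x3_def] x2 l
    by simp_all
  have pos3: "0 \<le> x3"
    using x3 l by linarith
  have x4: "50.29214 * l \<le> x4" "x4 \<le> 50.29228 * l"
    using mult_right_mono[OF q(1) pos3, folded x4_def] mult_right_mono[OF q(2) pos3, folded x4_def] x3 l
    by simp_all
  have p2: "12.52397 \<le> p * p" "p * p \<le> 12.52399"
    using mult_mono[OF p(1) p(1)] mult_mono[OF p(2) p(2)] p by auto
  have p3: "44.32136 \<le> p * (p * p)" "p * (p * p) \<le> 44.32146"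
    using mult_mono[OF p(1) p2(1)] mult_mono[OF p(2) p2(2)] p p2 by auto
  note bounds = p h r l x1 x2 x3 x4 p2 p3

  have near0: "near (d / p) l h A" "near (d / p) l B (1 + l - h)"
  proof -
    have "(1 + p * l - e + p - 1) / p = 1 + l - h"
      using p0 by (simp add: h_def field_simps)
    then show "near (d / p) l h A" "near (d / p) l B (1 + l - h)"
      using near_p[OF near] by (simp_all add: h_def A_def B_def)
  qed

  have w1: "l * (q - 1) = x1 - l" by (simp add: x1_def algebra_simps)
  note q1 = near_q[of _ l, folded x1_def, unfolded w1]
  \<comment> \<open>The two translates overlap in the middle, so only the gap and its translate stay
    open.\<close>
  have near31: "near (d / p) x1 h A" "near (d / p) x1 B (A + (x1 - l))"
    "near (d / p) x1 (B + (x1 - l)) (1 + l - h + (x1 - l))"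
    using q1[OF near0(1)] q1[OF near0(2)]
      near_union[OF q1(1)[OF near0(2)] q1(2)[OF near0(1)]] bounds
    unfolding A B by simp_all

  have w2: "x1 * (q - 1) = x2 - x1" by (simp add: x2_def algebra_simps)
  note q2 = near_q[of _ x1, folded x2_def, unfolded w2]
  have "h + (x2 - x1) \<le> 1 + l - h + (x1 - l)"
    using bounds by simp
  then have near62: "near (d / p) x2 h A" "near (d / p) x2 B (A + (x1 - l))"
    "near (d / p) x2 (B + (x1 - l)) (A + (x2 - x1))"
    "near (d / p) x2 (B + (x2 - x1)) (A + (x1 - l) + (x2 - x1))"
    using q2(1)[OF near31(1)] q2(1)[OF near31(2)] q2(2)[OF near31(2)]
      near_union[OF q2(1)[OF near31(3)] q2(2)[OF near31(1)]]
    by simp_all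

  have "x2 = p * (x2 / p)" using p0 by simp
  note p22 = near_p[of _ "x2 / p", folded this]
  have near22: "near (d / p / p) (x2 / p) (h / p) (A / p)"
    "near (d / p / p) (x2 / p) (B / p) ((A + (x1 - l)) / p)"
    using p22(1)[OF near62(1)] p22(1)[OF near62(2)] by simp_all
  \<comment> \<open>The leftmost pieces of the right copy bridge the third image of the gap, and the
    centre is reached.\<close>
  have "(h + p - 1) / p \<le> (A + (x2 - x1)) / p"
    using bounds by (intro divide_right_mono) (simp_all add: A)
  note u = near_union[OF p22(1)[OF near62(3)] p22(2)[OF near62(1)] this]
  have "(B + (x2 - x1)) / p \<le> (A + p - 1) / p"
    using bounds by (intro divide_right_mono) (simp_all add: A B)
  note u = near_union[OF u p22(1)[OF near62(4)] this]
  have "p + x2 \<le> 2 * (A + (x1 - l) + (x2 - x1))"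
    using bounds by (simp add: A)
  from divide_right_mono[OF this, of "p"] p0 have "1 + x2 / p \<le> 2 * ((A + (x1 - l) + (x2 - x1)) / p)"
    by (simp add: add_divide_distrib diff_divide_distrib)
  note near22c = near_central[OF u this, folded D_def]

  have w3: "x2 / p * (q - 1) = (x3 - x2) / p" "q * (x2 / p) = x3 / p"
    by (simp_all add: x3_def algebra_simps diff_divide_distrib)
  note q3 = near_q[of _ "x2 / p", unfolded w3]
  \<comment> \<open>The translated leftmost piece bridges the mirror image of the second
    gap.\<close>
  have "h + (x3 - x2) \<le> p + x2 - (B + (x1 - l))"
    using bounds by (simp add: B)
  from divide_right_mono[OF this, of "p"] p0 have "h / p + (x3 - x2) / p \<le> 1 + x2 / p - D"
    by (simp add: D_def add_divide_distrib diff_divide_distrib)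
  note u = near_union[OF q3(1)[OF near22c] q3(2)[OF near22(1)] this]
  have "p + x2 - (A + (x1 - l)) \<le> A + (x3 - x2)"
    using bounds by (simp add: A)
  from divide_right_mono[OF this, of "p"] p0 have "1 + x2 / p - (A + (x1 - l)) / p \<le> A / p + (x3 - x2) / p"
    by (simp add: add_divide_distrib diff_divide_distrib)
  note u = near_union[OF u q3(1)[OF near_reflect[OF near22(2)]] this]
  have "p + x3 \<le> 2 * (p + x2 - B)"
    using bounds by (simp add: B)
  from divide_right_mono[OF this, of "p"] p0 have "1 + x3 / p \<le> 2 * (1 + x2 / p - B / p)"
    by (simp add: add_divide_distrib diff_divide_distrib)
  note near53c = near_central[OF u this]
  note near53 = q3(1)[OF near22(2)]

  have "x3 / p = p * (x3 / p / p)" using p0 by simp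
  note p13 = near_p[of _ "x3 / p / p", folded this]
  note near13 = p13(1)[OF near53]
  \<comment> \<open>The piece between the first two gaps, placed in the right copy, carries the
    central interval past the midpoint.\<close>
  have "B + p * p - p \<le> p + x3 - (B + (x1 - l))"
    using bounds by (simp add: B)
  from divide_right_mono[OF this, of "p"] p0 have "B / p + p - 1 \<le> 1 + x3 / p - D"
    by (simp add: D_def add_divide_distrib diff_divide_distrib)
  then have "(B / p + p - 1) / p \<le> (1 + x3 / p - D) / p"
    using p0 by (intro divide_right_mono) auto
  note u = near_union[OF p13(1)[OF near53c] p13(2)[OF near53] this]
  have "p * p + x3 \<le> 2 * (A + (x1 - l) + p * p - p)"
    using bounds by (simp add: A)
  from divide_right_mono[OF this, of "p * p"] p0 have "1 + x3 / p / p \<le> 2 * (((A + (x1 - l)) / p + p - 1) / p)"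
    by (simp add: add_divide_distrib diff_divide_distrib)
  note near13c = near_central[OF u this]

  have q44: "q * (x3 / p / p) = x4 / p / p"
    by (simp add: x4_def)
  have "x4 - 2 * x3 + 2 * (B + (x1 - l)) \<le> p * p"
    using bounds by (simp add: B)
  \<comment> \<open>At exponent 44 the intervals trimmed by \<open>D / p\<close> overlap without any
    help from the outer pieces.\<close>
  from divide_right_mono[OF this, of "p * p"] p0 have "x3 / p / p * (q - 2) + 2 * (D / p) \<le> 1"
    by (simp add: D_def x4_def add_divide_distrib diff_divide_distrib right_diff_distrib mult.commute)
  note near44c = near_central_q[OF near13c this, unfolded q44]
  note near44 = near_q(1)[OF near13, unfolded q44]

  have "x4 / p / p = p * (x4 / p / p / p)" using p0 by simp
  note p4 = near_p[of _ "x4 / p / p / p", folded this]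
  have "B + p * (p * p) - p * p \<le> p * p + x4 - (B + (x1 - l))"
    using bounds by (simp add: B)
  from divide_right_mono[OF this, of "p * p"] p0 have "B / p / p + p - 1 \<le> 1 + x4 / p / p - D / p"
    by (simp add: D_def add_divide_distrib diff_divide_distrib)
  then have "(B / p / p + p - 1) / p \<le> (1 + x4 / p / p - D / p) / p"
    using p0 by (intro divide_right_mono) auto
  note u = near_union[OF p4(1)[OF near44c] p4(2)[OF near44] this]
  have "p * (p * p) + x4 \<le> 2 * (A + (x1 - l) + p * (p * p) - p * p)"
    using bounds by (simp add: A)
  from divide_right_mono[OF this, of "p * (p * p)"] p0 have "1 + x4 / p / p / p \<le> 2 * (((A + (x1 - l)) / p / p + p - 1) / p)"
    by (simp add: add_divide_distrib diff_divide_distrib)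
  note near4 = near_central[OF u this]
  \<comment> \<open>The remaining trim is at most about 0.0325.\<close>
  have "B + (x1 - l) \<le> 0.033 * (p * (p * p))"
    using bounds by (simp add: B)
  from divide_right_mono[OF this, of "p * (p * p)"] p0 have "D / p / p \<le> 0.033"
    by (simp add: D_def add_divide_distrib diff_divide_distrib)
  then show ?thesis
    using near_mono[OF near4] unfolding x4_def x3_def x2_def x1_def by simp
qed

section \<open>Returning along the cycle\<close>

text \<open>Two inequalities serve all steps: steps by -40 end at an exponent of at least 1
  (\<open>lo\<close>), and steps by +31 start from at most 39 (\<open>hi\<close>). The shrinking of
  \<open>d\<close> and \<open>e\<close> is discarded.\<close>

lemma near_cycle:
  assumes g: "g > 1" "p = g ^ 40" "q = g ^ 31" and q2: "q \<ge> 2"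
    and pos: "0 \<le> l" "0 \<le> d" "0 \<le> e"
    and lo: "p - 2 + 2 * e \<le> p * (l * g)" and hi: "l * g ^ 39 * (q - 2) + 2 * e \<le> 1"
    and i: "0 < i" and ij: "i \<le> j" "j \<le> 70"
    and near: "near d (l * g ^ (31 * i mod 71)) e (1 + l * g ^ (31 * i mod 71) - e)"
  shows "near d (l * g ^ (31 * j mod 71)) e (1 + l * g ^ (31 * j mod 71) - e)"
  using ij
proof (induction j rule: dec_induct)
  case base
  show ?case by (rule near)
next
  case (step j)
  let ?c = "31 * j mod 71"
  have IH: "near d (l * g ^ ?c) e (1 + l * g ^ ?c - e)"
    using step by simp
  consider "?c < 40" "31 * Suc j mod 71 = ?c + 31" | "40 < ?c" "31 * Suc j mod 71 + 40 = ?c"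
    using residue_step[of j] i step by auto
  then show ?case
  proof cases
    case 1
    have "g ^ ?c \<le> g ^ 39"
      using 1 g by (intro power_increasing) auto
    then have "l * g ^ ?c * (q - 2) \<le> l * g ^ 39 * (q - 2)"
      using pos q2 by (intro mult_right_mono mult_left_mono) auto
    then have "near d (q * (l * g ^ ?c)) e (1 + q * (l * g ^ ?c) - e)"
      using hi by (intro near_central_q[OF IH]) auto
    moreover have "q * (l * g ^ ?c) = l * g ^ (?c + 31)"
      by (simp add: g power_add)
    ultimately show ?thesis
      using 1 by simp
  next
    case 2
    let ?c' = "31 * Suc j mod 71"
    have c: "p * (l * g ^ ?c') = l * g ^ ?c"
      by (simp add: g flip: 2(2) power_add)
    have "0 < ?c'"
      using 2 by linarith
    then have "g ^ 1 \<le> g ^ ?c'"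
      using g by (intro power_increasing) auto
    then have "p * (l * g) \<le> p * (l * g ^ ?c')"
      using pos p_gt_1 by (intro mult_left_mono) auto
    then have "p - 2 + 2 * e \<le> l * g ^ ?c"
      using lo unfolding c by linarith
    then have "near (d / p) (l * g ^ ?c') (e / p) (1 + l * g ^ ?c' - e / p)"
      by (rule near_central_p[of d "l * g ^ ?c'" e, unfolded c, OF IH])
    moreover have "d / p \<le> d" "e / p \<le> e"
      using pos p_gt_1 by (auto simp: field_simps mult_le_cancel_left1)
    ultimately show ?thesis
      by (elim near_mono) auto
  qed
qed

text \<open>The exponent 0 is bypassed: from 40 the path goes to 71 and then to 31, which is stage 1
  of the cycle. The division by \<open>p\<close> on the way gives the gain in
  \<open>d\<close>.\<close>

lemma near_return_overlap:
  assumes g: "g > 1" "p = g ^ 40" "q = g ^ 31" and q2: "q \<ge> 2"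
    and pos: "0 \<le> l" "0 \<le> d"
    and lo: "p - 2 \<le> p * (l * g)" and hi: "l * p * (q - 2) \<le> 1"
    and near: "near d (p * l) 0 (1 + p * l)"
  shows "near (d / p) (p * l) 0 (1 + p * l)"
proof -
  have "g ^ 39 \<le> p" "g ^ 1 \<le> q"
    unfolding g(2,3) using g(1) by (intro power_increasing; simp)+
  then have hi': "l * g ^ 39 * (q - 2) \<le> l * p * (q - 2)" and lo': "p * (l * g) \<le> p * (l * q)"
    using pos q2 p_gt_1 by (auto intro!: mult_right_mono mult_left_mono)
  have "near d (q * (p * l)) 0 (1 + q * (p * l) - 0)"
    by (rule near_central_q) (use near hi in \<open>auto simp: mult.commute\<close>)
  then have "near d (p * (l * q)) 0 (1 + p * (l * q) - 0)"
    by (simp add: mult_ac)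
  from near_central_p[OF this] have "near (d / p) (l * q) 0 (1 + l * q - 0)"
    using lo lo' by simp
  then have "near (d / p) (l * g ^ (31 * 1 mod 71)) 0 (1 + l * g ^ (31 * 1 mod 71) - 0)"
    by (simp add: g(3))
  then have "near (d / p) (l * g ^ (31 * 70 mod 71)) 0 (1 + l * g ^ (31 * 70 mod 71) - 0)"
    by (rule near_cycle[OF g q2 pos(1), rotated -1]) (use pos p_gt_1 lo hi hi' in auto)
  then show ?thesis
    by (simp add: g(2) mult.commute)
qed

end

section \<open>The parameters given by \<gamma> = 1.0321\<close>

locale cantor_sum_gamma = cantor_sum +
  fixes g :: real
  assumes g_eq: "g = 1.0321" and p_eq: "p = g ^ 40" and q_eq: "q = g ^ 31"
begin

lemma p_bounds: "3.538923 \<le> p" "p \<le> 3.538924"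
  and q_bounds: "2.663024 \<le> q" "q \<le> 2.663025"
  by (simp_all add: p_eq q_eq g_eq power_divide divide_simps)

lemma g_gt_1: "g > 1"
  by (simp add: g_eq)

text \<open>The trim 0.033 is too large for the uniform bounds of \<open>near_cycle\<close>.
  Individual steps through the exponents 4, 35, 66, 26, 57, 17 first divide it by \<open>p\<close>
  twice.\<close>

lemma near_return_gap:
  assumes l: "0.42618 \<le> l" "l \<le> 0.43486" and d: "0 \<le> d"
    and near: "near d (p * l) 0.003 (1 + p * l - 0.003)"
  shows "near (d / p) (p * l) 0.003 (1 + p * l - 0.003)"
proof -
  have scale_q: "q * (l * g ^ n) = l * g ^ (n + 31)" for n
    by (simp add: q_eq power_add)
  have scale_p: "p * (l * g ^ 26) = l * g ^ 66" "p * (l * g ^ 17) = l * g ^ 57"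
    by (simp_all add: p_eq flip: power_add)
  have pow: "g ^ 4 \<le> 1.2" "g ^ 35 \<le> 3.03" "8 \<le> g ^ 66" "g ^ 26 \<le> 2.3" "6 \<le> g ^ 57"
    "1.032 \<le> g" "g ^ 39 \<le> 3.42887"
    by (simp_all add: g_eq power_divide divide_simps)
  have up: "l * g ^ n * (q - 2) \<le> 0.43486 * c * 0.663025" if "g ^ n \<le> c" for n c
  proof (rule mult_mono)
    have "0 \<le> g ^ n"
      using g_gt_1 by simp
    then have "0 \<le> c"
      using that by linarith
    then show "l * g ^ n \<le> 0.43486 * c" "0 \<le> 0.43486 * c"
      using mult_mono[OF l(2) that _ \<open>0 \<le> g ^ n\<close>] by simp_all
  qed (use q_bounds in simp_all)
  have low: "0.42618 * c \<le> l * g ^ n" if "c \<le> g ^ n" "0 \<le> c" for n c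
    using that l by (intro mult_mono) auto

  have "q * (q * (q * (q * l))) / p / p / p = l * g ^ 4"
    using g_gt_1 by (simp add: p_eq q_eq field_simps flip: power_add)
  then have "near (d / p / p / p / p) (l * g ^ 4) 0.033 (1 + l * g ^ 4 - 0.033)"
    using near_gap_chain[OF p_bounds q_bounds l _ _ near] by simp
  from near_central_q[OF this] have "near (d / p / p / p / p) (l * g ^ 35) 0.033 (1 + l * g ^ 35 - 0.033)"
    using up[OF pow(1)] by (simp add: scale_q)
  from near_central_q[OF this] have "near (d / p / p / p / p) (l * g ^ 66) 0.033 (1 + l * g ^ 66 - 0.033)"
    using up[OF pow(2)] by (simp add: scale_q)
  from near_central_p[of _ "l * g ^ 26", unfolded scale_p(1), OF this]
  have "near (d / p / p / p / p / p) (l * g ^ 26) (0.033 / p) (1 + l * g ^ 26 - 0.033 / p)"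
    using low[OF pow(3)] p_bounds by simp
  then have "near (d / p / p / p / p / p) (l * g ^ 26) 0.01 (1 + l * g ^ 26 - 0.01)"
    by (rule near_mono) (use p_bounds in \<open>auto simp: field_simps\<close>)
  from near_central_q[OF this] have "near (d / p / p / p / p / p) (l * g ^ 57) 0.01 (1 + l * g ^ 57 - 0.01)"
    using up[OF pow(4)] by (simp add: scale_q)
  from near_central_p[of _ "l * g ^ 17", unfolded scale_p(2), OF this]
  have "near (d / p / p / p / p / p / p) (l * g ^ 17) (0.01 / p) (1 + l * g ^ 17 - 0.01 / p)"
    using low[OF pow(5)] p_bounds by simp
  moreover have "d / p / p / p / p / p / p \<le> d / p"
  proof -
    have "x / p \<le> x" "0 \<le> x / p" if "0 \<le> x" for x
      using that p_gt_1 mult_right_mono[of 1 p x] by (auto simp: field_simps)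
    then show ?thesis
      using d by (meson order_trans)
  qed
  ultimately have "near (d / p) (l * g ^ 17) 0.003 (1 + l * g ^ 17 - 0.003)"
    by (elim near_mono) (use p_bounds in \<open>auto simp: field_simps\<close>)
  \<comment> \<open>Stage 12 of the cycle: 31 * 12 = 5 * 71 + 17.\<close>
  then have "near (d / p) (l * g ^ (31 * 12 mod 71)) 0.003 (1 + l * g ^ (31 * 12 mod 71) - 0.003)"
    by simp
  then have "near (d / p) (l * g ^ (31 * 70 mod 71)) 0.003 (1 + l * g ^ (31 * 70 mod 71) - 0.003)"
  proof (rule near_cycle[rotated -1])
    have "3.538923 * (0.42618 * 1.032) \<le> p * (l * g)"
      using l pow p_bounds by (intro mult_mono) auto
    then show "p - 2 + 2 * 0.003 \<le> p * (l * g)"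
      using p_bounds by simp
    show "l * g ^ 39 * (q - 2) + 2 * 0.003 \<le> 1"
      using up[OF pow(7)] by simp
  qed (use l d g_gt_1 p_eq q_eq q_bounds in simp_all)
  then show ?thesis
    by (simp add: p_eq mult.commute)
qed

section \<open>Transport of intervals along powers of \<gamma>\<close>

definition has_interval :: "real \<Rightarrow> bool" where
  "has_interval l \<longleftrightarrow> (\<exists>a b. a < b \<and> {a..b} \<subseteq> sumset l)"

text \<open>Starting from the error \<open>b\<close>, each return divides the error by
  \<open>p\<close>; the limit gives containment.\<close>

lemma has_interval_of_near:
  assumes "a < b" "0 \<le> a" and return: "\<And>d. 0 \<le> d \<Longrightarrow> near d l a b \<Longrightarrow> near (d / p) l a b"
  shows "has_interval l"
proof -
  have "near (b * (1 / p) ^ n) l a b" for n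
  proof (induction n)
    case 0
    show ?case using near_zero[OF assms(2)] by simp
  next
    case (Suc n)
    from return[OF _ this] show ?case
      using assms p_gt_1 by (simp add: mult_ac)
  qed
  then have "{a..b} \<subseteq> sumset l"
    by (rule near_limit) (use p_gt_1 in auto)
  then show ?thesis
    using assms(1) unfolding has_interval_def by blast
qed

lemma has_interval_fundamental:
  assumes "l \<le> 1 - 2 / p" "1 - 2 / p < l * g"
  shows "has_interval (p * l)"
proof -
  have p0: "p > 0"
    using p_gt_1 by auto
  have l: "l * p \<le> p - 2" "p - 2 < p * (l * g)"
    using assms p0 by (auto simp: field_simps)
  have "0 < p * l * g"
    using l p_bounds by (simp add: mult.assoc)
  then have l0: "0 < l"
    using p0 g_gt_1 by (simp add: zero_less_mult_iff)
  show ?thesis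
  proof (cases "l * p * (q - 2) \<le> 1")
    case True
    show ?thesis
    proof (rule has_interval_of_near[of 0 "1 + p * l"])
      fix d :: real assume "0 \<le> d" "near d (p * l) 0 (1 + p * l)"
      then show "near (d / p) (p * l) 0 (1 + p * l)"
        by (intro near_return_overlap[of g])
          (use True l l0 g_gt_1 p_eq q_eq q_bounds in auto)
    qed (use l0 p0 in \<open>auto simp: add_pos_pos\<close>)
  next
    case False
    \<comment> \<open>The range of \<open>l\<close> in the gap case is from 1/(p(q - 2)), about
      0.42619, to 1 - 2/p, about 0.43486.\<close>
    have "l * p * (q - 2) \<le> l * 3.538924 * 0.663025"
      using l0 p_bounds q_bounds by (intro mult_mono) auto
    then have "0.42618 \<le> l"
      using False by simp
    moreover have "l * 3.538923 \<le> l * p"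
      using l0 p_bounds by (intro mult_left_mono) auto
    then have "l \<le> 0.43486"
      using l p_bounds by simp
    ultimately show ?thesis
      using near_return_gap by (intro has_interval_of_near[of "0.003" "1 + p * l - 0.003"])
        (use l0 p0 in \<open>auto intro: less_le_trans[of _ 1]\<close>)
  qed
qed

lemma has_interval_div_p:
  assumes "has_interval (p * l)"
  shows "has_interval l"
proof -
  obtain a b where ab: "a < b" "{a..b} \<subseteq> sumset (p * l)"
    using assms unfolding has_interval_def by blast
  have "t \<in> sumset l" if "t \<in> {a / p..b / p}" for t
  proof -
    have "p * t \<in> sumset (p * l)"
      using that ab(2) p_gt_1 by (auto simp: field_simps)
    from sumset_p(1)[OF this] show ?thesis
      using p_gt_1 by simp
  qed
  moreover have "a / p < b / p"
    using ab(1) p_gt_1 by (simp add: divide_strict_right_mono)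
  ultimately show ?thesis
    unfolding has_interval_def by blast
qed

lemma has_interval_mult_q: "has_interval l \<Longrightarrow> has_interval (q * l)"
  using sumset_q(1) unfolding has_interval_def by blast

text \<open>Multiplication by \<open>q\<close> and division by \<open>p\<close> suffice, since both
  \<gamma> and its inverse have the form q^m / p^n.\<close>

lemma has_interval_renormalize:
  assumes "has_interval l"
  shows "has_interval (q ^ m * (l / p ^ n))"
proof -
  have "has_interval (l / p ^ n)"
  proof (induction n)
    case 0
    show ?case using assms by simp
  next
    case (Suc n)
    then have "has_interval (p * (l / p ^ Suc n))"
      using p_gt_1 by simp
    then show ?case by (rule has_interval_div_p)
  qed
  then show ?thesis
    by (induction m) (simp_all add: mult.assoc has_interval_mult_q del: times_divide_eq_right)
qed

lemma has_interval_mult_g: "has_interval l \<Longrightarrow> has_interval (l * g ^ n)"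
proof (induction n)
  case (Suc n)
  \<comment> \<open>31 * 31 - 40 * 24 = 1.\<close>
  have "q ^ 31 * (l * g ^ n / p ^ 24) = l * g ^ Suc n"
    using g_gt_1 unfolding q_eq p_eq by (simp add: field_simps flip: power_mult power_add power_Suc)
  then show ?case
    using has_interval_renormalize[OF Suc.IH[OF Suc.prems], of 31 24] by simp
qed simp

lemma has_interval_div_g: "has_interval l \<Longrightarrow> has_interval (l / g ^ n)"
proof (induction n)
  case (Suc n)
  \<comment> \<open>31 * 9 - 40 * 7 = -1.\<close>
  have "q ^ 9 * (l / g ^ n / p ^ 7) = l / g ^ Suc n"
    using g_gt_1 unfolding q_eq p_eq by (simp add: field_simps flip: power_mult power_add power_Suc)
  then show ?case
    using has_interval_renormalize[OF Suc.IH[OF Suc.prems], of 9 7] by simp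
qed simp

lemma has_interval_pos:
  assumes "l > 0"
  shows "has_interval l"
proof -
  define a where "a = 1 - 2 / p"
  have a: "a > 0"
    using p_bounds by (simp add: a_def field_simps)
  note g1 = g_gt_1
  \<comment> \<open>This exponent brings \<open>l * g powi k\<close> into the fundamental range
    between \<open>a / g\<close> (excluded) and \<open>a\<close>.\<close>
  define k where "k = \<lfloor>log g (a / l)\<rfloor>"
  define m where "m = l * g powi k"
  have m_eq: "m = g powr k * l"
    using g1 by (simp add: m_def powr_real_of_int')
  have "k \<le> log g (a / l)" "log g (a / l) < k + 1"
    unfolding k_def by linarith+
  moreover have "0 < a / l"
    using a assms by simp
  ultimately have "g powr k \<le> a / l" "a / l < g powr (k + 1)"
    using le_log_iff[OF g1] log_less_iff[OF g1] by auto
  then have "m \<le> a" "a < g powr (k + 1) * l"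
    using assms by (simp_all add: m_eq pos_le_divide_eq pos_divide_less_eq)
  moreover have "g powr (k + 1) * l = m * g"
    using g1 by (simp add: m_eq powr_add)
  ultimately have "m \<le> a" "a < m * g"
    by simp_all
  then have m: "has_interval m"
    unfolding a_def by (rule has_interval_div_p[OF has_interval_fundamental])
  show ?thesis
  proof (cases "k \<ge> 0")
    case True
    then have "l = m / g ^ nat k"
      using g1 by (simp add: m_def power_int_def)
    then show ?thesis
      using has_interval_div_g[OF m] by simp
  next
    case False
    then have "l = m * g ^ nat (- k)"
      using g1 by (simp add: m_def power_int_def field_simps)
    then show ?thesis
      using has_interval_mult_g[OF m] by simp
  qed
qed

end

theorem proposition3:
  fixes \<gamma> p q \<alpha> \<beta> l :: real
  assumes "\<gamma> = 1.0321"
    and "p = \<gamma> ^ 40"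
    and "q = \<gamma> ^ 31"
    and "\<alpha> = 1 - 2 / p"
    and "\<beta> = 1 - 2 / q"
    and "l \<noteq> 0"
  shows "\<exists>a b. a < b \<and>
           {a..b} \<subseteq> {x - l * y | x y. x \<in> middle_cantor \<alpha> \<and> y \<in> middle_cantor \<beta>}"
proof -
  have pq: "p > 1" "q > 1"
    unfolding assms(1-3) by (auto intro!: one_less_power)
  interpret cantor_sum_gamma p q \<gamma>
    by unfold_locales (fact pq assms(1-3))+
  have mc: "middle_cantor \<alpha> = cantor_set p" "middle_cantor \<beta> = cantor_set q"
    unfolding assms(4,5) using pq by (simp_all add: middle_cantor_eq)
  have "has_interval \<bar>l\<bar>"
    using assms(6) by (intro has_interval_pos) simp
  then obtain a b where ab: "a < b" "{a..b} \<subseteq> sumset \<bar>l\<bar>"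
    unfolding has_interval_def by blast
  show ?thesis
  \<comment> \<open>For positive \<open>l\<close>, replacing \<open>y\<close> by
    \<open>1 - y\<close> makes the difference set the translate of the sum set by
    \<open>- l\<close>; for negative \<open>l\<close> the two sets coincide.\<close>
  proof (cases "l > 0")
    case True
    have "\<exists>x y. t = x - l * y \<and> x \<in> cantor_set p \<and> y \<in> cantor_set q"
      if "t \<in> {a - l..b - l}" for t
    proof -
      have "t + l \<in> sumset l"
        using that ab(2) True by (auto simp: algebra_simps)
      then obtain x y where xy: "t + l = x + l * y" "x \<in> cantor_set p" "y \<in> cantor_set q"
        unfolding sumset_def by blast
      then have "t = x - l * (1 - y)"
        by (simp add: algebra_simps)
      with xy cantor_set_reflect[OF pq(2) xy(3)] show ?thesis
        by blast
    qed
    then show ?thesis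
      using ab(1) unfolding mc by (intro exI[of _ "a - l"] exI[of _ "b - l"]) auto
  next
    case False
    then have "sumset \<bar>l\<bar> = {x - l * y | x y. x \<in> cantor_set p \<and> y \<in> cantor_set q}"
      by (simp add: sumset_def)
    then show ?thesis
      using ab unfolding mc by auto
  qed
qed
end
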